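(* Deterministic consensus with $m$-bit inputs in a fault-free multiple access channel with beeps requires $\Omega(m)$ rounds, even when all processors are woken up spontaneously in the same round. That is, there is a constant $c>0$ such that, for all sufficiently large $m$ and every deterministic algorithm $\mathcal{A}$ that solves consensus (for every number of processors on the channel and every assignment of $m$-bit inputs to them), there exists an execution of $\mathcal{A}$ that uses at least $c\,m$ rounds.
   Context: **Model.** A finite nonempty set of processors shares a multiple access channel: all processors communicate directly. Communication proceeds in synchronous rounds, and all processors wake up spontaneously in the same round. In each round a processor either beeps or listens. There are no faults: a processor hears a beep in a round if and only if it listens in this round and one or more other processors beep in this round. The number of processors on the channel is arbitrary and not known to the processors (in particular a processor may be alone on the channel). In a deterministic algorithm, the action of a processor (beep, listen, output) in each round is a function of its input value and of what it has heard in earlier rounds, the same function for all processors. **Consensus with $m$-bit inputs.** Each processor has an input value from the set $V$ of all $2^m$ bit strings of length $m$. Requirements: Termination: all processors output some value from $V$. Agreement: all output values are equal. Validity: if all input values are equal to $v$, then all output values are equal to $v$. The number of rounds used by an execution is the number of rounds until all processors have output. *)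

theory Defs
  imports Complex_Main
begin

datatype action = Beep | Listen

text \<open>The value set \<open>V\<close>.\<close>

definition bit_strings :: "nat \<Rightarrow> bool list set" where
  "bit_strings m = {v. length v = m}"

text \<open>
  The history of a processor after \<open>t\<close> rounds is a list of length \<open>t\<close>, earliest round first, whose
  \<open>i\<close>-th entry says whether a beep was heard in the \<open>i\<close>-th round. The processor's own earlier actions
  are determined by its input and its history, so they need not be recorded.

  \<open>act v h\<close> is the action in round \<open>length h + 1\<close> of a processor with input \<open>v\<close> and history \<open>h\<close>;
  \<open>decide v h\<close> is \<open>Some w\<close> if this processor outputs \<open>w\<close> after its first \<open>length h\<close> rounds. Only the
  first output of a processor counts. Outputting does not silence a processor; an algorithm
  in which processors halt on output is one that listens from then on.
\<close>

record algorithm =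
  act :: "bool list \<Rightarrow> bool list \<Rightarrow> action"
  decide :: "bool list \<Rightarrow> bool list \<Rightarrow> bool list option"

text \<open>
  An execution is determined by the algorithm, the set \<open>P\<close> of processors on the channel and the
  input assignment \<open>x\<close>. The elements of \<open>P\<close> are names used only to describe the execution: the
  algorithm has access neither to them nor to \<open>card P\<close>.
\<close>

primrec history :: "algorithm \<Rightarrow> 'p set \<Rightarrow> ('p \<Rightarrow> bool list) \<Rightarrow> nat \<Rightarrow> 'p \<Rightarrow> bool list" where
  "history A P x 0 p = []"
| "history A P x (Suc t) p =
     history A P x t p @
       [act A (x p) (history A P x t p) = Listen \<and>
        (\<exists>q\<in>P. q \<noteq> p \<and> act A (x q) (history A P x t q) = Beep)]"

definition outputs_at :: "algorithm \<Rightarrow> 'p set \<Rightarrow> ('p \<Rightarrow> bool list) \<Rightarrow> 'p \<Rightarrow> nat \<Rightarrow> bool" where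
  "outputs_at A P x p t \<longleftrightarrow> decide A (x p) (history A P x t p) \<noteq> None"

text \<open>The two \<open>LEAST\<close> definitions below are meaningful only when the processors concerned output.\<close>

definition output_value :: "algorithm \<Rightarrow> 'p set \<Rightarrow> ('p \<Rightarrow> bool list) \<Rightarrow> 'p \<Rightarrow> bool list" where
  "output_value A P x p =
     the (decide A (x p) (history A P x (LEAST t. outputs_at A P x p t) p))"

definition rounds_used :: "algorithm \<Rightarrow> 'p set \<Rightarrow> ('p \<Rightarrow> bool list) \<Rightarrow> nat" where
  "rounds_used A P x = (LEAST t. \<forall>p\<in>P. \<exists>s\<le>t. outputs_at A P x p s)"

definition terminates :: "nat \<Rightarrow> algorithm \<Rightarrow> 'p set \<Rightarrow> ('p \<Rightarrow> bool list) \<Rightarrow> bool" where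
  "terminates m A P x \<longleftrightarrow>
     (\<forall>p\<in>P. (\<exists>t. outputs_at A P x p t) \<and> output_value A P x p \<in> bit_strings m)"

definition agreement :: "algorithm \<Rightarrow> 'p set \<Rightarrow> ('p \<Rightarrow> bool list) \<Rightarrow> bool" where
  "agreement A P x \<longleftrightarrow> (\<forall>p\<in>P. \<forall>q\<in>P. output_value A P x p = output_value A P x q)"

definition validity :: "algorithm \<Rightarrow> 'p set \<Rightarrow> ('p \<Rightarrow> bool list) \<Rightarrow> bool" where
  "validity A P x \<longleftrightarrow> (\<forall>v. (\<forall>p\<in>P. x p = v) \<longrightarrow> (\<forall>p\<in>P. output_value A P x p = v))"

text \<open>Natural numbers serve as processor names, so that every finite number of processors occurs.\<close>

definition consensus_instance :: "nat \<Rightarrow> nat set \<Rightarrow> (nat \<Rightarrow> bool list) \<Rightarrow> bool" where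
  "consensus_instance m P x \<longleftrightarrow> finite P \<and> P \<noteq> {} \<and> (\<forall>p\<in>P. x p \<in> bit_strings m)"

definition solves_consensus :: "nat \<Rightarrow> algorithm \<Rightarrow> bool" where
  "solves_consensus m A \<longleftrightarrow>
     (\<forall>P x. consensus_instance m P x \<longrightarrow>
        terminates m A P x \<and> agreement A P x \<and> validity A P x)"

end

theory Submission
  imports Defs
begin

text \<open>
  A processor alone on the channel hears nothing, so its actions are a fixed sequence determined by
  its input. If two inputs \<open>v \<noteq> w\<close> had the same sequence up to the round by which both have output
  when alone, then two processors with inputs \<open>v\<close> and \<open>w\<close> would always beep simultaneously, hence
  hear nothing, and output \<open>v\<close> and \<open>w\<close> respectively by validity, against agreement. So the \<open>2 ^ m\<close>
  inputs yield distinct binary sequences, whose length is therefore at least \<open>m\<close>.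
\<close>

text \<open>\<open>replicate i False\<close> is the history of a processor that has heard nothing
  for \<open>i\<close> rounds. Taking a set of inputs covers both a solo run, where the condition is
  trivial, and a run with two inputs.\<close>

definition lockstep :: "algorithm \<Rightarrow> nat \<Rightarrow> bool list set \<Rightarrow> bool" where
  "lockstep A t V \<longleftrightarrow>
     (\<forall>i<t. \<forall>v\<in>V. \<forall>w\<in>V. act A v (replicate i False) = act A w (replicate i False))"

lemma lockstep_antimono: "lockstep A t V \<Longrightarrow> s \<le> t \<Longrightarrow> lockstep A s V"
  unfolding lockstep_def by (meson less_le_trans)

text \<open>By induction all histories are silent so far, so in the next round either everyone in
  \<open>P\<close> beeps or everyone listens; in neither case is a beep heard.\<close>

lemma history_lockstep:
  assumes "lockstep A t (x ` P)" and "p \<in> P"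
  shows "history A P x t p = replicate t False"
  using assms
proof (induction t arbitrary: p)
  case 0
  then show ?case by simp
next
  case (Suc t)
  have "lockstep A t (x ` P)"
    using Suc.prems(1) lockstep_antimono le_SucI by blast
  then have silent: "history A P x t q = replicate t False" if "q \<in> P" for q
    using Suc.IH that by blast
  have "\<not> (act A (x p) (replicate t False) = Listen \<and>
      (\<exists>q\<in>P. q \<noteq> p \<and> act A (x q) (replicate t False) = Beep))"
    using Suc.prems unfolding lockstep_def by (metis action.distinct(1) imageI lessI)
  then have "\<not> (act A (x p) (history A P x t p) = Listen \<and>
      (\<exists>q\<in>P. q \<noteq> p \<and> act A (x q) (history A P x t q) = Beep))"
    using silent Suc.prems(2) by metis
  then have "history A P x (Suc t) p = replicate t False @ [False]"
    using silent[OF Suc.prems(2)] by (simp only: history.simps)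
  then show ?case
    by (simp add: replicate_append_same)
qed

text \<open>Depends on the input alone, not on \<open>P\<close> or \<open>x\<close>; this carries an
  output value from a solo run over to a run with two processors.\<close>

definition silent_output :: "algorithm \<Rightarrow> bool list \<Rightarrow> bool list" where
  "silent_output A v =
     the (decide A v (replicate (LEAST t. decide A v (replicate t False) \<noteq> None) False))"

lemma output_value_lockstep:
  assumes "lockstep A t (x ` P)" and "p \<in> P"
    and "s \<le> t" and "decide A (x p) (replicate s False) \<noteq> None"
  shows "output_value A P x p = silent_output A (x p)"
proof -
  let ?D = "\<lambda>s. decide A (x p) (replicate s False) \<noteq> None"
  have hist: "history A P x i p = replicate i False" if "i \<le> t" for i
    using history_lockstep[OF lockstep_antimono[OF assms(1) that] assms(2)] .
  then have iff: "outputs_at A P x p i \<longleftrightarrow> ?D i" if "i \<le> t" for i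
    using that by (simp add: outputs_at_def)
  have le: "Least ?D \<le> t"
    using Least_le[of ?D s] assms(3,4) by linarith
  have "(LEAST i. outputs_at A P x p i) = Least ?D"
  proof (rule Least_equality)
    show "outputs_at A P x p (Least ?D)"
      using iff[OF le] LeastI[of ?D s] assms(4) by simp
  next
    \<comment> \<open>Beyond round \<open>t\<close> the history is unknown, but such an
      \<open>i\<close> already exceeds \<open>Least ?D\<close>, which is at most
      \<open>t\<close>.\<close>
    fix i assume "outputs_at A P x p i"
    then show "Least ?D \<le> i"
      using iff[of i] le Least_le[of ?D i] by (cases "i \<le> t") auto
  qed
  then show ?thesis
    by (simp only: output_value_def silent_output_def hist[OF le])
qed

text \<open>Finiteness of \<open>P\<close> gives a common bound on the output times, so the
  \<open>LEAST\<close> in \<open>rounds_used\<close> is attained.\<close>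

lemma outputs_by_rounds_used:
  assumes "finite P" and "\<And>p. p \<in> P \<Longrightarrow> \<exists>t. outputs_at A P x p t" and "p \<in> P"
  shows "\<exists>s\<le>rounds_used A P x. outputs_at A P x p s"
proof -
  obtain f where f: "\<And>p. p \<in> P \<Longrightarrow> outputs_at A P x p (f p)"
    using assms(2) by metis
  have "\<forall>p\<in>P. \<exists>s\<le>Max (f ` P). outputs_at A P x p s"
    using f assms(1) by (meson Max_ge finite_imageI imageI)
  then have "\<forall>p\<in>P. \<exists>s\<le>rounds_used A P x. outputs_at A P x p s"
    unfolding rounds_used_def by (rule LeastI)
  then show ?thesis
    using assms(3) by blast
qed

text \<open>A single input is in lockstep with itself for any number of rounds, so the solo run is
  silent and validity fixes its output.\<close>

lemma solo_output:
  assumes "solves_consensus m A" and "v \<in> bit_strings m"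
  shows "\<exists>s\<le>rounds_used A {0::nat} (\<lambda>_. v). decide A v (replicate s False) \<noteq> None"
    and "silent_output A v = v"
proof -
  let ?P = "{0::nat}" and ?x = "\<lambda>_::nat. v"
  have "consensus_instance m ?P ?x"
    using assms(2) by (simp add: consensus_instance_def)
  then have sol: "terminates m A ?P ?x" "validity A ?P ?x"
    using assms(1) by (auto simp: solves_consensus_def)
  have lock: "lockstep A t (?x ` ?P)" for t
    by (simp add: lockstep_def)
  obtain s where s: "s \<le> rounds_used A ?P ?x" "outputs_at A ?P ?x 0 s"
    using outputs_by_rounds_used[of ?P A ?x 0] sol(1) by (auto simp: terminates_def)
  then have dec: "decide A v (replicate s False) \<noteq> None"
    using history_lockstep[OF lock, of 0 s] by (simp add: outputs_at_def)
  with s(1) show "\<exists>s\<le>rounds_used A ?P ?x. decide A v (replicate s False) \<noteq> None"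
    by blast
  show "silent_output A v = v"
    using output_value_lockstep[OF lock, of 0 s s] dec sol(2) by (simp add: validity_def)
qed

text \<open>Since \<open>t\<close> bounds both solo running times, each of two processors with
  inputs \<open>v\<close> and \<open>w\<close> outputs its own input while the channel is still
  silent to it; agreement then applies.\<close>

lemma lockstep_inputs_equal:
  assumes sol: "solves_consensus m A"
    and v: "v \<in> bit_strings m" "rounds_used A {0::nat} (\<lambda>_. v) \<le> t"
    and w: "w \<in> bit_strings m" "rounds_used A {0::nat} (\<lambda>_. w) \<le> t"
    and lock: "lockstep A t {v, w}"
  shows "v = w"
proof -
  define x where "x = (\<lambda>p::nat. if p = 0 then v else w)"
  let ?P = "{0, 1::nat}"
  have lock': "lockstep A t (x ` ?P)"
    using lock by (simp add: x_def insert_commute)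
  have "output_value A ?P x p = x p"
    if p: "p \<in> ?P" and xp: "x p \<in> bit_strings m"
      and le: "rounds_used A {0::nat} (\<lambda>_. x p) \<le> t" for p
  proof -
    obtain s where "s \<le> t" "decide A (x p) (replicate s False) \<noteq> None"
      using solo_output(1)[OF sol xp] le le_trans by blast
    then show ?thesis
      using output_value_lockstep[OF lock' p] solo_output(2)[OF sol xp] by simp
  qed
  from this[of 0] this[of 1] have "output_value A ?P x 0 = v" "output_value A ?P x 1 = w"
    using v w by (simp_all add: x_def)
  moreover have "agreement A ?P x"
    using sol v(1) w(1) by (simp add: solves_consensus_def consensus_instance_def x_def)
  ultimately show ?thesis
    unfolding agreement_def by (metis insertCI)
qed

lemma card_bit_strings: "card (bit_strings m) = 2 ^ m"
  using card_lists_length_eq[of "UNIV :: bool set" m] by (simp add: bit_strings_def)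

lemma consensus_solo_rounds:
  assumes sol: "solves_consensus m A"
  shows "\<exists>v\<in>bit_strings m. m \<le> rounds_used A {0::nat} (\<lambda>_. v)"
proof (rule ccontr)
  assume contra: "\<not> ?thesis"
  have less: "rounds_used A {0::nat} (\<lambda>_. v) < m" if "v \<in> bit_strings m" for v
    using that contra not_le by blast
  \<comment> \<open>Makes \<open>m - 1\<close> a genuine predecessor, so that
    \<open>2 ^ (m - 1) < 2 ^ m\<close> at the end.\<close>
  have "m > 0"
    using less[of "replicate m False"] by (simp add: bit_strings_def)
  \<comment> \<open>The solo beeping pattern of \<open>v\<close> as a set of rounds counted from 0.
    By \<open>less\<close>, all solo runs finish within \<open>m - 1\<close> rounds, so equal
    patterns force equal inputs.\<close>
  define f where "f v = {i. i < m - 1 \<and> act A v (replicate i False) = Beep}" for v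
  have "inj_on f (bit_strings m)"
  proof (rule inj_onI)
    fix v w
    assume *: "v \<in> bit_strings m" "w \<in> bit_strings m" "f v = f w"
    have "act A v (replicate i False) = act A w (replicate i False)" if "i < m - 1" for i
    proof -
      have "i \<in> f v \<longleftrightarrow> i \<in> f w"
        using *(3) by simp
      then show ?thesis
        using that by (cases "act A v (replicate i False)"; cases "act A w (replicate i False)")
          (auto simp: f_def)
    qed
    then have "lockstep A (m - 1) {v, w}"
      by (auto simp: lockstep_def)
    then show "v = w"
      using lockstep_inputs_equal[OF sol *(1) _ *(2), of "m - 1"] less[OF *(1)] less[OF *(2)] by simp
  qed
  moreover have "f ` bit_strings m \<subseteq> Pow {..<m - 1}"
    by (auto simp: f_def)
  ultimately have "card (bit_strings m) \<le> card (Pow {..<m - 1})"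
    by (intro card_inj_on_le[where f = f]) auto
  then show False
    using \<open>m > 0\<close> by (simp add: card_bit_strings card_Pow)
qed

theorem theorem3p2:
  shows "\<exists>c::real. c > 0 \<and>
    (\<exists>M::nat. \<forall>m\<ge>M. \<forall>A::algorithm. solves_consensus m A \<longrightarrow>
      (\<exists>(P::nat set) (x::nat \<Rightarrow> bool list).
         consensus_instance m P x \<and> real (rounds_used A P x) \<ge> c * real m))"
\<comment> \<open>The solo bound holds for every \<open>m\<close> with constant 1, hence
  \<open>c = 1\<close> and \<open>M = 0\<close>.\<close>
proof (intro exI[of _ "1::real"] conjI exI[of _ "0::nat"] allI impI)
  fix m A
  assume "solves_consensus m A"
  then obtain v where "v \<in> bit_strings m" "m \<le> rounds_used A {0::nat} (\<lambda>_. v)"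
    using consensus_solo_rounds by blast
  then have "consensus_instance m {0} (\<lambda>_. v) \<and>
      real (rounds_used A {0::nat} (\<lambda>_. v)) \<ge> 1 * real m"
    by (simp add: consensus_instance_def)
  then show "\<exists>(P::nat set) x. consensus_instance m P x \<and> real (rounds_used A P x) \<ge> 1 * real m"
    by blast
qed simp

end
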